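(* Let $\mathcal B=(B_i)_{i\in\mathbb N}$ be any dynamical hierarchy and let $m\in\mathbb N$. Then there is $i\in\mathbb N$ such that $\mathbb G^{\mathcal B}_i(m)=0$.
   Context: Let $\mathbb N=\{0,1,2,\dots\}$; the symbol $\infty$ is regarded as greater than, and divisible by, every positive integer. For $b\ge 2$ and $n>0$, the $b$-decomposition of $n$ is the unique representation $n=b^e a+r$ with $b^e\le n<b^{e+1}$, $0<a<b$, $r<b^e$. For nonempty $B\subseteq\mathbb N\setminus\{0,1\}$ and $n\in\mathbb N$ let $\mathrm{base}_B(n)=\max\{b\in B: b\le n\}$ if $n\ge\min B$ and $\mathrm{base}_B(n)=\min B$ otherwise; let $S_B(n)=\min\{b\in B:b>n\}$ if this set is nonempty and $S_B(n)=\infty$ otherwise. A base hierarchy is a nonempty $B\subseteq\mathbb N\setminus\{0,1\}$ with $b\mid S_B(b)$ for all $b\in B$. Upgrade: for base hierarchies $B,C$ with $\min B\le\min C$, define ${\uparrow}n={\uparrow}_B^C n\in\mathbb N\cup\{\infty\}$ by recursion on $n$. If $n<\min B$, ${\uparrow}n=n$. Otherwise let $b=\mathrm{base}_B(n)$; assuming ${\uparrow}$ defined below $n$, for $c\in C$ define $\langle b\to c\rangle m$ for $m\le n$ by $\langle b\to c\rangle m={\uparrow}m$ if $m<b$, and $\langle b\to c\rangle m=c^{\langle b\to c\rangle e}\cdot{\uparrow}a+\langle b\to c\rangle r$ if $m\ge b$ has $b$-decomposition $m=b^ea+r$. Then ${\uparrow}n=\langle b\to c\rangle n$ where $c$ (the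 witness for ${\uparrow}n$) is the least element of $C$ with ${\uparrow}(n-1)<\langle b\to c\rangle n<S_C(c)$; if no such $c$ exists, ${\uparrow}n=\infty$. $C$ is a good successor of $B$ if (1) $\min B\le\min C$; (2) ${\uparrow}_B^C n<\infty$ for all $n\in\mathbb N$; (3) for every $b\in B$ with $b>\min B$, writing $x={\uparrow}_B^C(b-1)$, there is no multiple of $\mathrm{base}_C(x)$ strictly between $x$ and $S_C(x)$. A dynamical hierarchy is a sequence $\mathcal B=(B_i)_{i\in\mathbb N}$ of base hierarchies with each $B_{i+1}$ a good successor of $B_i$. The Goodstein sequence: $\mathbb G^{\mathcal B}_0(n)=n$, and $\mathbb G^{\mathcal B}_{i+1}(n)={\uparrow}_{B_i}^{B_{i+1}}\mathbb G^{\mathcal B}_i(n)-1$ if $\mathbb G^{\mathcal B}_i(n)>0$, else $\mathbb G^{\mathcal B}_{i+1}(n)=0$. *)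

theory Defs
  imports Main "HOL-Library.Extended_Nat"
begin

definition is_decomposition :: "nat \<Rightarrow> nat \<Rightarrow> nat \<times> nat \<times> nat \<Rightarrow> bool" where
  "is_decomposition b n = (\<lambda>(e, a, r).
     n = b ^ e * a + r \<and> b ^ e \<le> n \<and> n < b ^ (e + 1) \<and> 0 < a \<and> a < b \<and> r < b ^ e)"

lemma ex1_decomposition:
  assumes b: "2 \<le> b" and n: "0 < n"
  shows "\<exists>!d. is_decomposition b n d"
proof -
  have exp: "\<exists>e. b ^ e \<le> n \<and> n < b ^ (e + 1)"
  proof -
    have lt: "n < b ^ n" using b by (intro less_le_trans[OF less_exp power_mono]) auto
    define k where "k = (LEAST k. n < b ^ k)"
    have k: "n < b ^ k" unfolding k_def using lt by (rule LeastI)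
    have "k \<noteq> 0" using k n by (intro notI) simp
    then obtain e where e: "k = Suc e" by (cases k) auto
    have "\<not> n < b ^ e" using not_less_Least[of e "\<lambda>k. n < b ^ k"] e unfolding k_def by auto
    then show ?thesis using k e by (intro exI[of _ e]) simp
  qed
  then obtain e where e: "b ^ e \<le> n" "n < b ^ (e + 1)" by blast
  have pos: "0 < b ^ e" using b by simp
  have a: "0 < n div b ^ e" using e pos by (simp add: div_greater_zero_iff)
  have a': "n div b ^ e < b" using e(2) pos by (simp add: div_less_iff_less_mult mult.commute)
  show ?thesis
  proof (rule ex1I)
    show "is_decomposition b n (e, n div b ^ e, n mod b ^ e)"
      using e a a' pos by (simp add: is_decomposition_def)
  next
    fix d assume d: "is_decomposition b n d"
    obtain e' a'' r where dd: "d = (e', a'', r)" by (cases d)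
    have h: "n = b ^ e' * a'' + r" "b ^ e' \<le> n" "n < b ^ (e' + 1)" "r < b ^ e'"
      using d by (auto simp: dd is_decomposition_def)
    have "b ^ e' < b ^ (e + 1)" "b ^ e < b ^ (e' + 1)"
      using h(2,3) e by linarith+
    then have "e' < e + 1" "e < e' + 1"
      using b power_less_imp_less_exp[of b e' "e + 1"] power_less_imp_less_exp[of b e "e' + 1"]
      by linarith+
    then have ee: "e' = e" by simp
    have "n div b ^ e = a''" "n mod b ^ e = r"
      using h(4) pos by (simp_all add: h(1) ee)
    then show "d = (e, n div b ^ e, n mod b ^ e)" by (simp add: dd ee)
  qed
qed

definition decomposition :: "nat \<Rightarrow> nat \<Rightarrow> nat \<times> nat \<times> nat" where
  "decomposition b n = (THE d. is_decomposition b n d)"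

lemma is_decomposition_decomposition:
  "2 \<le> b \<Longrightarrow> 0 < n \<Longrightarrow> is_decomposition b n (decomposition b n)"
  unfolding decomposition_def by (rule theI') (rule ex1_decomposition)

lemma decomposition_eqI:
  "2 \<le> b \<Longrightarrow> 0 < n \<Longrightarrow> is_decomposition b n d \<Longrightarrow> decomposition b n = d"
  unfolding decomposition_def by (rule the1_equality[OF ex1_decomposition])

lemma is_decomposition_less:
  assumes "2 \<le> b" "is_decomposition b n (e, a, r)"
  shows "e < n" "r < n"
proof -
  have "e < b ^ e" using assms(1) by (intro less_le_trans[OF less_exp power_mono]) auto
  then show "e < n" "r < n" using assms(2) by (auto simp: is_decomposition_def)
qed

text \<open>On infinite sets of naturals \<open>Min\<close> is unspecified, hence minima are written \<open>Inf\<close>,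
  which on a nonempty set of naturals is its least element.\<close>

definition base :: "nat set \<Rightarrow> nat \<Rightarrow> nat" where
  "base B n = (if Inf B \<le> n then Max {b \<in> B. b \<le> n} else Inf B)"

definition next_base :: "nat set \<Rightarrow> nat \<Rightarrow> enat" where
  "next_base B n = (if \<exists>b\<in>B. n < b then enat (Inf {b \<in> B. n < b}) else \<infinity>)"

text \<open>Divisibility below is that of the semiring \<^typ>\<open>enat\<close>, where every positive integer
  divides \<open>\<infinity>\<close>.\<close>

definition base_hierarchy :: "nat set \<Rightarrow> bool" where
  "base_hierarchy B \<longleftrightarrow> B \<noteq> {} \<and> B \<subseteq> UNIV - {0, 1} \<and> (\<forall>b\<in>B. enat b dvd next_base B b)"

lemma enat_dvd_infinity: "0 < b \<Longrightarrow> enat b dvd \<infinity>"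
  by (rule dvdI[of _ _ \<infinity>]) (simp add: times_enat_def)

lemma enat_dvd_enat_iff: "0 < b \<Longrightarrow> enat b dvd enat n \<longleftrightarrow> b dvd n"
proof
  assume b: "0 < b" and "enat b dvd enat n"
  then obtain k where "enat n = enat b * k" by (elim dvdE)
  with b show "b dvd n" by (cases k) (auto simp: times_enat_def split: if_splits)
next
  assume "b dvd n"
  then obtain k where "n = b * k" by (elim dvdE)
  then show "enat b dvd enat n" by (intro dvdI[of _ _ "enat k"]) simp
qed

text \<open>The value at \<open>\<infinity>\<close> is immaterial: once an upgrade is \<open>\<infinity>\<close>,
  so are all later ones.\<close>

definition enat_pow :: "nat \<Rightarrow> enat \<Rightarrow> enat" where
  "enat_pow c x = (case x of enat k \<Rightarrow> enat (c ^ k) | \<infinity> \<Rightarrow> \<infinity>)"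

text \<open>\<open>base_change up b c m\<close> is \<open>\<langle>b \<rightarrow> c\<rangle> m\<close>, relative to the upgrade operator \<open>up\<close>, which is only
  evaluated below \<open>b\<close>. The case \<open>b < 2\<close> is included for termination only.\<close>

function base_change :: "(nat \<Rightarrow> enat) \<Rightarrow> nat \<Rightarrow> nat \<Rightarrow> nat \<Rightarrow> enat" where
  "base_change up b c m =
     (if m < b \<or> b < 2 then up m
      else case decomposition b m of (e, a, r) \<Rightarrow>
        enat_pow c (base_change up b c e) * up a + base_change up b c r)"
  by pat_completeness auto
termination
proof (relation "measure (\<lambda>(up, b, c, m). m)", goal_cases)
  case 1
  show ?case by simp
next
  case (2 up b c m e y a r)
  then have "2 \<le> b" "is_decomposition b m (e, a, r)"
    using is_decomposition_decomposition[of b m] by auto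
  then show ?case by (simp add: is_decomposition_less)
next
  case (3 up b c m e y a r)
  then have "2 \<le> b" "is_decomposition b m (e, a, r)"
    using is_decomposition_decomposition[of b m] by auto
  then show ?case by (simp add: is_decomposition_less)
qed

declare base_change.simps [simp del]

lemma base_change_less: "m < b \<Longrightarrow> base_change up b c m = up m"
  by (simp add: base_change.simps)

lemma base_change_ge:
  assumes "2 \<le> b" "b \<le> m" "is_decomposition b m (e, a, r)"
  shows "base_change up b c m =
    enat_pow c (base_change up b c e) * up a + base_change up b c r"
  using assms by (subst base_change.simps) (simp add: decomposition_eqI)

lemma base_change_cong:
  assumes "2 \<le> b" "\<And>k. k < b \<Longrightarrow> up k = up' k"
  shows "base_change up b c m = base_change up' b c m"
proof (induction m rule: less_induct)
  case (less m)
  show ?case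
  proof (cases "m < b")
    case True
    then show ?thesis using assms by (simp add: base_change_less)
  next
    case False
    obtain e a r where d: "is_decomposition b m (e, a, r)"
      using is_decomposition_decomposition[of b m] False assms(1)
      by (cases "decomposition b m") auto
    have "a < b" using d by (simp add: is_decomposition_def)
    then have "up a = up' a" by (rule assms(2))
    moreover have "base_change up b c e = base_change up' b c e"
      "base_change up b c r = base_change up' b c r"
      using less.IH is_decomposition_less[OF assms(1) d] by blast+
    moreover have "b \<le> m" using False by simp
    ultimately show ?thesis
      by (simp only: base_change_ge[OF assms(1) _ d])
  qed
qed

text \<open>The restriction to \<open>k < n\<close> only serves termination; it is removed in \<open>upgrade_ge\<close>.\<close>

function upgrade :: "nat set \<Rightarrow> nat set \<Rightarrow> nat \<Rightarrow> enat" where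
  "upgrade B C n =
     (if n < Inf B \<or> n = 0 then enat n
      else let b = base B n;
               change = (\<lambda>c. base_change (\<lambda>k. if k < n then upgrade B C k else \<infinity>) b c n);
               witness = (\<lambda>c. c \<in> C \<and> upgrade B C (n - 1) < change c \<and> change c < next_base C c)
           in if \<exists>c. witness c then change (LEAST c. witness c) else \<infinity>)"
  by pat_completeness auto
termination
  by (relation "measure (\<lambda>(B, C, n). n)") auto

declare upgrade.simps [simp del]

definition is_witness :: "nat set \<Rightarrow> nat set \<Rightarrow> nat \<Rightarrow> nat \<Rightarrow> bool" where
  "is_witness B C n c \<longleftrightarrow> c \<in> C \<and>
     upgrade B C (n - 1) < base_change (upgrade B C) (base B n) c n \<and>
     base_change (upgrade B C) (base B n) c n < next_base C c"

lemma base_hierarchy_base: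
  assumes "base_hierarchy B" "Inf B \<le> n"
  shows "base B n \<in> B" "base B n \<le> n" "2 \<le> base B n"
proof -
  have "Inf B \<in> B" using assms(1) by (simp add: base_hierarchy_def Inf_nat_def1)
  then have "{b \<in> B. b \<le> n} \<noteq> {}" using assms(2) by blast
  then have *: "base B n \<in> {b \<in> B. b \<le> n}"
    using Max_in[of "{b \<in> B. b \<le> n}"] assms(2) by (simp add: base_def)
  then show B: "base B n \<in> B" "base B n \<le> n" by auto
  have "base B n \<noteq> 0" "base B n \<noteq> 1"
    using B(1) assms(1) by (auto simp: base_hierarchy_def)
  then show "2 \<le> base B n" by linarith
qed

lemma upgrade_less: "n < Inf B \<Longrightarrow> upgrade B C n = enat n"
  by (simp add: upgrade.simps)

lemma upgrade_ge:
  assumes "base_hierarchy B" "Inf B \<le> n"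
  shows "upgrade B C n =
    (if \<exists>c. is_witness B C n c
     then base_change (upgrade B C) (base B n) (LEAST c. is_witness B C n c) n
     else \<infinity>)"
proof -
  note b = base_hierarchy_base[OF assms]
  have "base_change (\<lambda>k. if k < n then upgrade B C k else \<infinity>) (base B n) c n =
      base_change (upgrade B C) (base B n) c n" for c
    using b by (intro base_change_cong) auto
  then show ?thesis
    using b assms(2) by (subst upgrade.simps, simp add: is_witness_def[abs_def] Let_def, blast)
qed

definition good_successor :: "nat set \<Rightarrow> nat set \<Rightarrow> bool" where
  "good_successor B C \<longleftrightarrow>
     Inf B \<le> Inf C \<and>
     (\<forall>n. upgrade B C n < \<infinity>) \<and>
     (\<forall>b\<in>B. Inf B < b \<longrightarrow>
        (let x = the_enat (upgrade B C (b - 1)) in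
         \<not> (\<exists>k. base C x dvd k \<and> x < k \<and> enat k < next_base C x)))"

definition dynamical_hierarchy :: "(nat \<Rightarrow> nat set) \<Rightarrow> bool" where
  "dynamical_hierarchy \<B> \<longleftrightarrow>
     (\<forall>i. base_hierarchy (\<B> i)) \<and> (\<forall>i. good_successor (\<B> i) (\<B> (Suc i)))"

text \<open>For a dynamical hierarchy all upgrades are finite, so \<^const>\<open>the_enat\<close> only changes
  the type.\<close>

fun goodstein :: "(nat \<Rightarrow> nat set) \<Rightarrow> nat \<Rightarrow> nat \<Rightarrow> nat" where
  "goodstein \<B> 0 n = n"
| "goodstein \<B> (Suc i) n =
     (if 0 < goodstein \<B> i n
      then the_enat (upgrade (\<B> i) (\<B> (Suc i)) (goodstein \<B> i n)) - 1
      else 0)"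

end

theory Submission
  imports Defs
begin

text \<open>The upgrade maps between consecutive stages are strictly increasing, so a Goodstein sequence
  is a descending sequence in their direct limit, and it suffices that the limit is well-founded.
  Write a number in hereditary normal form over its base, replace the base by a formal symbol
  \<open>\<Omega>\<close> and the coefficients by their images in the limit. The resulting term does not change
  under upgrades, although the base itself may grow at every stage, so an element of the limit
  behaves like a collapse of its term. As in well-foundedness proofs for such collapsing functions,
  let \<open>W\<close> be the accessible part of the limit: the terms with coefficients in \<open>W\<close> are
  well-founded, and induction on them shows that a number all of whose predecessors at one stage
  lie in \<open>W\<close> lies in \<open>W\<close> itself. Leastness of witnesses and condition (3) on good successors
  control the predecessors that appear at later stages.\<close>

section \<open>Hereditary terms over a well-founded order\<close>

text \<open>\<open>Pow e a r\<close> stands for \<Omega>^e * a + r, and \<open>Coef\<close> for a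
  value below \<Omega>.\<close>

datatype 'a tm = Coef 'a | Pow "'a tm" 'a "'a tm"

fun tm_less :: "('a \<Rightarrow> 'a \<Rightarrow> bool) \<Rightarrow> 'a tm \<Rightarrow> 'a tm \<Rightarrow> bool" where
  "tm_less R (Coef x) (Coef y) = R x y"
| "tm_less R (Coef x) (Pow e a r) = True"
| "tm_less R (Pow e a r) (Coef x) = False"
| "tm_less R (Pow e a r) (Pow e' a' r') =
     (tm_less R e e' \<or> e = e' \<and> (R a a' \<or> a = a' \<and> tm_less R r r'))"

text \<open>Expresses that a term lies below \<Omega>^e, so that \<open>normal_tm\<close> mirrors
  the condition r < b^e of a decomposition.\<close>

fun lead_less :: "('a \<Rightarrow> 'a \<Rightarrow> bool) \<Rightarrow> 'a tm \<Rightarrow> 'a tm \<Rightarrow> bool" where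
  "lead_less R (Coef x) e = True"
| "lead_less R (Pow e' a r) e = tm_less R e' e"

fun normal_tm :: "('a \<Rightarrow> 'a \<Rightarrow> bool) \<Rightarrow> 'a tm \<Rightarrow> bool" where
  "normal_tm R (Coef x) = True"
| "normal_tm R (Pow e a r) = (normal_tm R e \<and> normal_tm R r \<and> lead_less R r e)"

lemma tm_less_trans:
  assumes "transp R"
  shows "tm_less R s t \<Longrightarrow> tm_less R t v \<Longrightarrow> tm_less R s v"
proof (induction s arbitrary: t v)
  case (Coef x)
  then show ?case
    by (cases t; cases v) (auto intro: transpD[OF assms])
next
  case (Pow e a r)
  then obtain e1 a1 r1 e2 a2 r2 where "t = Pow e1 a1 r1" "v = Pow e2 a2 r2"
    by (cases t; cases v) auto
  with Pow show ?case
    by (auto intro: transpD[OF assms])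
qed

definition acc_tm :: "('a \<Rightarrow> 'a \<Rightarrow> bool) \<Rightarrow> 'a tm \<Rightarrow> bool" where
  "acc_tm R t \<longleftrightarrow> normal_tm R t \<and> (\<forall>x\<in>set_tm t. Wellfounded.accp R x)"

text \<open>Normality of both sides matters: otherwise a remainder may exceed its leading power, and
  \<open>tm_less\<close> can descend forever even over a well-founded \<open>R\<close>.\<close>

definition acc_tm_less :: "('a \<Rightarrow> 'a \<Rightarrow> bool) \<Rightarrow> 'a tm \<Rightarrow> 'a tm \<Rightarrow> bool" where
  "acc_tm_less R s t \<longleftrightarrow> acc_tm R s \<and> acc_tm R t \<and> tm_less R s t"

lemma acc_tm_PowD:
  assumes "acc_tm R (Pow e a r)"
  shows "acc_tm R e" "acc_tm R r" "Wellfounded.accp R a" "lead_less R r e"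
  using assms by (auto simp: acc_tm_def)

lemma accp_Coef:
  "Wellfounded.accp R x \<Longrightarrow> Wellfounded.accp (acc_tm_less R) (Coef x)"
proof (induction rule: accp.induct)
  case (accI x)
  show ?case
  proof (rule accp.accI)
    fix s assume "acc_tm_less R s (Coef x)"
    then have "tm_less R s (Coef x)" by (simp add: acc_tm_less_def)
    then show "Wellfounded.accp (acc_tm_less R) s"
      using accI.IH by (cases s) simp_all
  qed
qed

text \<open>Nested accessibility inductions on exponent, coefficient and remainder follow the
  lexicographic order.\<close>

lemma accp_Pow:
  assumes R: "transp R" and e: "Wellfounded.accp (acc_tm_less R) e"
  shows "Wellfounded.accp R a \<Longrightarrow> Wellfounded.accp (acc_tm_less R) r \<Longrightarrow>
    acc_tm R (Pow e a r) \<Longrightarrow> Wellfounded.accp (acc_tm_less R) (Pow e a r)"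
  using e
proof (induction arbitrary: a r rule: accp.induct)
  case (accI e)
  \<comment> \<open>All admissible terms below \<Omega>^e are accessible: structural induction
    handles the remainder, the outer hypothesis the smaller exponent.\<close>
  have lead: "Wellfounded.accp (acc_tm_less R) s"
    if "acc_tm R e" "acc_tm R s" "lead_less R s e" for s
    using that
  proof (induction s)
    case (Coef x)
    then show ?case by (auto simp: acc_tm_def intro: accp_Coef)
  next
    case (Pow e' a' r')
    note D = acc_tm_PowD[OF Pow.prems(2)]
    have "lead_less R r' e"
      using D(4) Pow.prems(3) by (cases r') (auto intro: tm_less_trans[OF R])
    then have r': "Wellfounded.accp (acc_tm_less R) r'"
      using Pow.IH(2) Pow.prems(1) D(2) by blast
    have "acc_tm_less R e' e"
      using D Pow.prems by (simp add: acc_tm_less_def)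
    then show ?case
      using accI.IH r' D(3) Pow.prems(2) by blast
  qed
  from accI.prems show ?case
  proof (induction arbitrary: r rule: accp.induct)
    case (accI a)
    note IHa = accI.IH
    from accI.prems show ?case
    proof (induction rule: accp.induct)
      case (accI r)
      note De = acc_tm_PowD[OF accI.prems]
      show ?case
      proof (rule accp.accI)
        fix s assume s: "acc_tm_less R s (Pow e a r)"
        then have ns: "acc_tm R s" by (simp add: acc_tm_less_def)
        show "Wellfounded.accp (acc_tm_less R) s"
        proof (cases s)
          case (Coef x)
          then show ?thesis using ns by (auto simp: acc_tm_def intro: accp_Coef)
        next
          case (Pow e' a' r')
          note D = acc_tm_PowD[OF ns[unfolded Pow]]
          consider "tm_less R e' e" | "e' = e" "R a' a"
            | "e' = e" "a' = a" "tm_less R r' r"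
            using s Pow by (auto simp: acc_tm_less_def)
          then show ?thesis
          proof cases
            case 1
            then show ?thesis using lead[OF De(1) ns] Pow by simp
          next
            \<comment> \<open>When the coefficient drops, \<open>r'\<close> bears no relation to
              \<open>r\<close>, but it lies below \<Omega>^e, so \<open>lead\<close> makes it
              accessible.\<close>
            case 2
            then have "Wellfounded.accp (acc_tm_less R) r'"
              using lead[OF De(1) D(2)] D(4) by simp
            then show ?thesis using IHa[OF 2(2)] 2(1) ns Pow by simp
          next
            case 3
            then have "acc_tm_less R r' r" using D De by (simp add: acc_tm_less_def)
            then show ?thesis using accI.IH 3 ns Pow by simp
          qed
        qed
      qed
    qed
  qed
qed

lemma accp_acc_tm_less:
  assumes "transp R"
  shows "acc_tm R t \<Longrightarrow> Wellfounded.accp (acc_tm_less R) t"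
proof (induction t)
  case (Coef x)
  then show ?case by (auto simp: acc_tm_def intro: accp_Coef)
next
  case (Pow e a r)
  then show ?case using accp_Pow[OF assms] acc_tm_PowD[OF Pow.prems] by blast
qed

section \<open>Base decompositions and base change\<close>

lemma decompositionE:
  assumes "2 \<le> b" "b \<le> n"
  obtains e a r where "is_decomposition b n (e, a, r)" "0 < e" "e < n" "r < n"
    "n = b ^ e * a + r" "0 < a" "a < b" "r < b ^ e" "b ^ e \<le> n"
proof -
  obtain e a r where d: "is_decomposition b n (e, a, r)"
    using is_decomposition_decomposition[of b n] assms by (cases "decomposition b n") auto
  moreover have "0 < e"
  proof (rule ccontr)
    assume "\<not> 0 < e"
    then show False using d assms by (simp add: is_decomposition_def)
  qed
  ultimately show ?thesis
    using that[of e a r] is_decomposition_less[OF assms(1) d]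
    by (simp add: is_decomposition_def del: power_Suc)
qed

lemma is_decompositionI:
  assumes "n = b ^ e * a + r" "0 < a" "a < b" "r < b ^ e"
  shows "is_decomposition b n (e, a, r)"
proof -
  have "b ^ e * a + r < b ^ e * (a + 1)" using assms(4) by simp
  also have "\<dots> \<le> b ^ e * b" using assms(3) by (intro mult_le_mono2) simp
  finally have "n < b ^ (e + 1)" using assms(1) by (simp add: mult.commute)
  moreover have "b ^ e * 1 \<le> b ^ e * a" using assms(2) by (intro mult_le_mono2) simp
  then have "b ^ e \<le> n" using assms(1) by linarith
  ultimately show ?thesis using assms unfolding is_decomposition_def by simp
qed

lemma decomposition_less_cases:
  assumes b: "2 \<le> b"
    and d: "is_decomposition b m (e, a, r)" and d': "is_decomposition b m' (e', a', r')"
    and less: "m < m'"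
  obtains "e < e'" | "e = e'" "a < a'" | "e = e'" "a = a'" "r < r'"
proof -
  have "b ^ e < b ^ (e' + 1)" using d d' less by (simp add: is_decomposition_def)
  then have "e < e' + 1" using b power_less_imp_less_exp[of b e "e' + 1"] by simp
  then consider "e < e'" | "e = e'" by linarith
  then show ?thesis
  proof cases
    case 2
    have "a \<le> a'"
    proof (rule ccontr)
      assume "\<not> a \<le> a'"
      then have "b ^ e * (a' + 1) \<le> b ^ e * a" by (intro mult_le_mono2) simp
      then show False using d d' less 2 by (simp add: is_decomposition_def)
    qed
    then show ?thesis using that 2 d d' less by (cases "a = a'") (auto simp: is_decomposition_def)
  qed (rule that(1))
qed

text \<open>For a finite-valued operator and \<open>b\<close> at least 2, base change stays finite
  (\<open>base_change_eq_nat_change\<close>), so the arithmetic can move from \<open>enat\<close> to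
  \<open>nat\<close>.\<close>

definition nat_change :: "(nat \<Rightarrow> nat) \<Rightarrow> nat \<Rightarrow> nat \<Rightarrow> nat \<Rightarrow> nat" where
  "nat_change u b c m = the_enat (base_change (\<lambda>k. enat (u k)) b c m)"

lemma nat_change_less: "m < b \<Longrightarrow> nat_change u b c m = u m"
  by (simp add: nat_change_def base_change_less)

lemma base_change_eq_nat_change:
  assumes "2 \<le> b"
  shows "base_change (\<lambda>k. enat (u k)) b c m = enat (nat_change u b c m)"
proof (induction m rule: less_induct)
  case (less m)
  show ?case
  proof (cases "m < b")
    case True
    then show ?thesis by (simp add: nat_change_less base_change_less)
  next
    case False
    then obtain e a r where d: "is_decomposition b m (e, a, r)" "e < m" "r < m"
      using decompositionE[OF assms, of m] by (metis not_less)
    have "base_change (\<lambda>k. enat (u k)) b c m =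
        enat (c ^ nat_change u b c e * u a + nat_change u b c r)"
      using False less d by (simp add: base_change_ge[OF assms _ d(1)] enat_pow_def)
    then show ?thesis by (simp add: nat_change_def)
  qed
qed

lemma nat_change_ge:
  assumes "2 \<le> b" "b \<le> m" "is_decomposition b m (e, a, r)"
  shows "nat_change u b c m = c ^ nat_change u b c e * u a + nat_change u b c r"
  using base_change_ge[OF assms, of "\<lambda>k. enat (u k)" c]
  by (simp add: base_change_eq_nat_change[OF assms(1)] enat_pow_def)

lemma nat_change_mono_base:
  assumes "2 \<le> b" "0 < c" "c \<le> c'"
  shows "nat_change u b c m \<le> nat_change u b c' m"
proof (induction m rule: less_induct)
  case (less m)
  show ?case
  proof (cases "m < b")
    case True
    then show ?thesis by (simp add: nat_change_less)
  next
    case False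
    then obtain e a r where d: "is_decomposition b m (e, a, r)" "e < m" "r < m"
      using decompositionE[OF assms(1), of m] by (metis not_less)
    have "c ^ nat_change u b c e \<le> c' ^ nat_change u b c e"
      using assms by (intro power_mono) auto
    also have "\<dots> \<le> c' ^ nat_change u b c' e"
      using assms less d by (intro power_increasing) auto
    finally show ?thesis
      using False less d by (simp add: nat_change_ge[OF assms(1) _ d(1)] add_mono)
  qed
qed

text \<open>The expansion of a multiple of \<open>b\<close> has no constant digit, and positive
  exponents stay positive under the change, so every summand is a multiple of
  \<open>c\<close>.\<close>

lemma nat_change_dvd:
  assumes "2 \<le> b" "0 < c" "u 0 = 0" "strict_mono u"
  shows "b dvd m \<Longrightarrow> c dvd nat_change u b c m"
proof (induction m rule: less_induct)
  case (less m)
  show ?case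
  proof (cases "m < b")
    case True
    then have "m = 0" using less.prems by (auto dest: dvd_imp_le)
    then show ?thesis using True assms by (simp add: nat_change_less)
  next
    case False
    then obtain e a r where d: "is_decomposition b m (e, a, r)" "e < m" "r < m" "0 < e"
      "m = b ^ e * a + r"
      using decompositionE[OF assms(1), of m] by (metis not_less)
    have "b dvd b ^ e * a" using d(4) by (simp add: dvd_power)
    then have "b dvd r" using less.prems d(5) by (simp add: dvd_add_right_iff)
    then have r: "c dvd nat_change u b c r" using less.IH d(3) by blast
    have "nat_change u b c e > 0"
    proof (cases "e < b")
      case True
      then show ?thesis using strict_monoD[OF assms(4) d(4)] by (simp add: nat_change_less)
    next
      case False
      then obtain e' a' r' where d': "is_decomposition b e (e', a', r')" "0 < a'"
        using decompositionE[OF assms(1), of e] by (metis not_less)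
      then show ?thesis
        using False strict_monoD[OF assms(4) d'(2)] assms(2)
        by (simp add: nat_change_ge[OF assms(1) _ d'(1)])
    qed
    then have "c dvd c ^ nat_change u b c e" by (simp add: dvd_power)
    then show ?thesis using False r by (simp add: nat_change_ge[OF assms(1) _ d(1)])
  qed
qed

text \<open>Adding \<open>r\<close> to a multiple of \<open>b\<close> touches only the constant
  digit; no carry can occur.\<close>

lemma nat_change_add:
  assumes "2 \<le> b" "u 0 = 0" "r < b"
  shows "b dvd m \<Longrightarrow> nat_change u b c (m + r) = nat_change u b c m + u r"
proof (induction m rule: less_induct)
  case (less m)
  show ?case
  proof (cases "m < b")
    case True
    then have "m = 0" using less.prems by (auto dest: dvd_imp_le)
    then show ?thesis using True assms by (simp add: nat_change_less)
  next
    case False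
    then obtain e a s where d: "is_decomposition b m (e, a, s)" "s < m" "0 < e"
      "m = b ^ e * a + s" "0 < a" "a < b" "s < b ^ e"
      using decompositionE[OF assms(1), of m] by (metis not_less)
    have "b dvd b ^ e * a" using d(3) by (simp add: dvd_power)
    then have s: "b dvd s" using less.prems d(4) by (simp add: dvd_add_right_iff)
    have "b dvd b ^ e" using d(3) by (simp add: dvd_power)
    \<comment> \<open>The gap between \<open>s\<close> and the leading power is a positive multiple
      of \<open>b\<close>, hence leaves room for \<open>r\<close>.\<close>
    then have "b dvd b ^ e - s" using s by simp
    then have "b \<le> b ^ e - s" using d(7) by (intro dvd_imp_le) auto
    then have "s + r < b ^ e" using assms(3) by linarith
    then have d': "is_decomposition b (m + r) (e, a, s + r)"
      using d by (intro is_decompositionI) auto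
    show ?thesis
      using False less.IH[OF d(2) s]
      by (simp add: nat_change_ge[OF assms(1) _ d(1)] nat_change_ge[OF assms(1) _ d'])
  qed
qed

lemma nat_change_base:
  assumes "2 \<le> b" "u 0 = 0" "u 1 = 1"
  shows "nat_change u b c (b ^ e) = (if e = 0 then 1 else c ^ nat_change u b c e)"
proof (cases "e = 0")
  case True
  then show ?thesis using assms by (simp add: nat_change_less)
next
  case False
  have d: "is_decomposition b (b ^ e) (e, 1, 0)"
    using assms(1) by (intro is_decompositionI) auto
  have "b \<le> b ^ e" using assms(1) False by (simp add: self_le_power)
  then show ?thesis
    using False assms nat_change_ge[OF assms(1) _ d] by (simp add: nat_change_less)
qed

text \<open>The bound on \<open>c\<close> makes the images of all digits valid digits in base
  \<open>c\<close>, so the lexicographic comparison of decompositions survives the change.\<close>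

lemma nat_change_strict_mono:
  assumes b: "2 \<le> b" and u: "strict_mono u" "u 0 = 0" "u 1 = 1" and c: "u (b - 1) < c"
  shows "m' < m \<Longrightarrow> nat_change u b c m' < nat_change u b c m"
proof (induction m arbitrary: m' rule: less_induct)
  case (less m)
  have small: "u k < c" if "k < b" for k
    using that c strict_mono_less_eq[OF u(1), of k "b - 1"] by linarith
  have c1: "1 < c" using small[of 1] u(3) b by simp
  show ?case
  proof (cases "m < b")
    case True
    then show ?thesis using less.prems strict_monoD[OF u(1)] by (simp add: nat_change_less)
  next
    case False
    then have m: "b \<le> m" by simp
    obtain e a r where d: "is_decomposition b m (e, a, r)" "e < m" "r < m" "0 < e" "0 < a"
      using decompositionE[OF b m] by metis
    have v: "nat_change u b c m = c ^ nat_change u b c e * u a + nat_change u b c r"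
      by (rule nat_change_ge[OF b m d(1)])
    have "u a \<ge> 1" using strict_monoD[OF u(1) d(5)] by simp
    then have ce: "c ^ nat_change u b c e \<le> nat_change u b c m"
      using v c1 by (metis le_add1 mult.right_neutral mult_le_mono2 order_trans)
    show ?thesis
    proof (cases "m' < b")
      case True
      have "nat_change u b c 0 < nat_change u b c e" using less.IH d by blast
      then have "c ^ 1 \<le> c ^ nat_change u b c e"
        using c1 by (intro power_increasing) auto
      then show ?thesis using ce small[OF True] True by (simp add: nat_change_less)
    next
      case False
      then have m': "b \<le> m'" by simp
      obtain e' a' r' where d': "is_decomposition b m' (e', a', r')" "e' < m'" "r' < m'"
          "0 < e'" "0 < a'" "a' < b" "r' < b ^ e'" "b ^ e' \<le> m'"
        using decompositionE[OF b m'] by metis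
      have v': "nat_change u b c m' = c ^ nat_change u b c e' * u a' + nat_change u b c r'"
        by (rule nat_change_ge[OF b m' d'(1)])
      \<comment> \<open>The induction hypothesis applies at \<open>b ^ e'\<close>, which is at most
        \<open>m'\<close>; it keeps the new remainder below the new leading power.\<close>
      have "nat_change u b c r' < nat_change u b c (b ^ e')"
        using less.IH[of "b ^ e'"] d' less.prems by simp
      then have "nat_change u b c r' < c ^ nat_change u b c e'"
        using d'(4) by (simp add: nat_change_base[OF b u(2,3)])
      then have lt: "nat_change u b c m' < c ^ nat_change u b c e' * (u a' + 1)"
        using v' by simp
      show ?thesis
        using b d'(1) d(1) less.prems
      proof (cases rule: decomposition_less_cases)
        case 1
        then have "nat_change u b c e' < nat_change u b c e" using less.IH d by blast
        have "c ^ nat_change u b c e' * (u a' + 1) \<le> c ^ nat_change u b c e' * c"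
          using small[OF d'(6)] by (intro mult_le_mono2) simp
        also have "\<dots> = c ^ (nat_change u b c e' + 1)" by simp
        also have "\<dots> \<le> c ^ nat_change u b c e"
          using c1 \<open>nat_change u b c e' < nat_change u b c e\<close> by (intro power_increasing) auto
        finally show ?thesis using lt ce by linarith
      next
        case 2
        have "c ^ nat_change u b c e' * (u a' + 1) \<le> c ^ nat_change u b c e' * u a"
          using strict_monoD[OF u(1) 2(2)] by (intro mult_le_mono2) simp
        then show ?thesis using lt v 2(1) by simp
      next
        case 3
        then show ?thesis using v v' less.IH d(3) by simp
      qed
    qed
  qed
qed

text \<open>Base change thus carries normal forms to normal forms, which is what makes terms
  invariant under it.\<close>

lemma is_decomposition_nat_change:
  assumes b: "2 \<le> b" and u: "strict_mono u" "u 0 = 0" "u 1 = 1" and c: "u (b - 1) < c"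
    and m: "b \<le> m" and d: "is_decomposition b m (e, a, r)"
  shows "is_decomposition c (nat_change u b c m) (nat_change u b c e, u a, nat_change u b c r)"
proof (rule is_decompositionI)
  show "nat_change u b c m = c ^ nat_change u b c e * u a + nat_change u b c r"
    by (rule nat_change_ge[OF b m d])
  have a: "0 < a" "a \<le> b - 1" using d by (auto simp: is_decomposition_def)
  show "0 < u a" using strict_monoD[OF u(1) a(1)] by simp
  show "u a < c" using a(2) c strict_mono_less_eq[OF u(1), of a "b - 1"] by linarith
  have "r < b ^ e" using d by (simp add: is_decomposition_def)
  then have "nat_change u b c r < nat_change u b c (b ^ e)"
    by (rule nat_change_strict_mono[OF b u c])
  moreover have "e \<noteq> 0"
  proof
    assume "e = 0"
    then show False using d m by (simp add: is_decomposition_def)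
  qed
  ultimately show "nat_change u b c r < c ^ nat_change u b c e"
    by (simp add: nat_change_base[OF b u(2,3)])
qed

lemma nat_change_ge_base:
  assumes b: "2 \<le> b" and u: "strict_mono u" "u 0 = 0" "u 1 = 1" and c: "u (b - 1) < c"
    and m: "b \<le> m"
  shows "c \<le> nat_change u b c m"
proof -
  have "nat_change u b c b = c"
    using nat_change_base[OF b u(2,3), of c 1] b u(3) by (simp add: nat_change_less)
  then show ?thesis
    using nat_change_strict_mono[OF b u c, of b m] m by (cases "b = m") auto
qed

section \<open>The term of a number\<close>

function to_tm :: "(nat \<Rightarrow> 'a) \<Rightarrow> nat \<Rightarrow> nat \<Rightarrow> 'a tm" where
  "to_tm f b n =
     (if n < b \<or> b < 2 then Coef (f n)
      else case decomposition b n of (e, a, r) \<Rightarrow> Pow (to_tm f b e) (f a) (to_tm f b r))"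
  by pat_completeness auto
termination
proof (relation "measure (\<lambda>(f, b, n). n)", goal_cases)
  case 1
  show ?case by simp
next
  case (2 f b m e y a r)
  then have "2 \<le> b" "is_decomposition b m (e, a, r)"
    using is_decomposition_decomposition[of b m] by auto
  then show ?case by (simp add: is_decomposition_less)
next
  case (3 f b m e y a r)
  then have "2 \<le> b" "is_decomposition b m (e, a, r)"
    using is_decomposition_decomposition[of b m] by auto
  then show ?case by (simp add: is_decomposition_less)
qed

declare to_tm.simps [simp del]

lemma to_tm_less: "n < b \<Longrightarrow> to_tm f b n = Coef (f n)"
  by (simp add: to_tm.simps)

lemma to_tm_ge:
  assumes "2 \<le> b" "b \<le> n" "is_decomposition b n (e, a, r)"
  shows "to_tm f b n = Pow (to_tm f b e) (f a) (to_tm f b r)"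
  using assms by (subst to_tm.simps) (simp add: decomposition_eqI)

lemma tm_less_to_tm:
  assumes b: "2 \<le> b" and f: "\<And>k k'. k < k' \<Longrightarrow> k' < b \<Longrightarrow> R (f k) (f k')"
  shows "m' < m \<Longrightarrow> tm_less R (to_tm f b m') (to_tm f b m)"
proof (induction m arbitrary: m' rule: less_induct)
  case (less m)
  show ?case
  proof (cases "m < b")
    case True
    then show ?thesis using less.prems f by (simp add: to_tm_less)
  next
    case False
    then have m: "b \<le> m" by simp
    obtain e a r where d: "is_decomposition b m (e, a, r)" "e < m" "r < m" "a < b"
      using decompositionE[OF b m] by metis
    show ?thesis
    proof (cases "m' < b")
      case True
      then show ?thesis by (simp add: to_tm_less to_tm_ge[OF b m d(1)])
    next
      case False
      then have m': "b \<le> m'" by simp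
      obtain e' a' r' where d': "is_decomposition b m' (e', a', r')"
        using decompositionE[OF b m'] by metis
      from b d' d(1) less.prems show ?thesis
        by (cases rule: decomposition_less_cases)
          (use less.IH f d in \<open>auto simp: to_tm_ge[OF b m d(1)] to_tm_ge[OF b m' d']\<close>)
    qed
  qed
qed

lemma normal_to_tm:
  assumes b: "2 \<le> b" and f: "\<And>k k'. k < k' \<Longrightarrow> k' < b \<Longrightarrow> R (f k) (f k')"
  shows "normal_tm R (to_tm f b m)"
proof (induction m rule: less_induct)
  case (less m)
  show ?case
  proof (cases "m < b")
    case True
    then show ?thesis by (simp add: to_tm_less)
  next
    case False
    then have m: "b \<le> m" by simp
    obtain e a r where d: "is_decomposition b m (e, a, r)" "e < m" "r < m" "r < b ^ e"
      using decompositionE[OF b m] by metis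
    have "lead_less R (to_tm f b r) (to_tm f b e)"
    proof (cases "r < b")
      case True
      then show ?thesis by (simp add: to_tm_less)
    next
      case False
      then have r: "b \<le> r" by simp
      obtain e' a' r' where d': "is_decomposition b r (e', a', r')" "b ^ e' \<le> r"
        using decompositionE[OF b r] by metis
      then have "b ^ e' < b ^ e" using d(4) by linarith
      then have "e' < e" using b power_less_imp_less_exp[of b e' e] by simp
      then show ?thesis
        using tm_less_to_tm[where R = R and f = f, OF b f]
        by (simp add: to_tm_ge[OF b r d'(1)])
    qed
    then show ?thesis using less.IH d by (simp add: to_tm_ge[OF b m d(1)])
  qed
qed

lemma set_to_tm:
  assumes b: "2 \<le> b"
  shows "set_tm (to_tm f b m) \<subseteq> f ` {..<b}"
proof (induction m rule: less_induct)
  case (less m)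
  show ?case
  proof (cases "m < b")
    case True
    then show ?thesis by (simp add: to_tm_less)
  next
    case False
    then have m: "b \<le> m" by simp
    obtain e a r where d: "is_decomposition b m (e, a, r)" "e < m" "r < m" "a < b"
      using decompositionE[OF b m] by metis
    then show ?thesis using less.IH[of e] less.IH[of r] by (auto simp: to_tm_ge[OF b m d(1)])
  qed
qed

text \<open>The expansion over \<open>c\<close> has the same shape with digits \<open>u k\<close>,
  from which \<open>g\<close> reads the coefficients that \<open>f\<close> reads from
  \<open>k\<close>.\<close>

lemma to_tm_nat_change:
  assumes b: "2 \<le> b" and u: "strict_mono u" "u 0 = 0" "u 1 = 1" and c: "u (b - 1) < c"
    and fg: "\<And>k. k < b \<Longrightarrow> g (u k) = f k"
  shows "to_tm g c (nat_change u b c m) = to_tm f b m"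
proof (induction m rule: less_induct)
  case (less m)
  have small: "u k < c" if "k < b" for k
    using that c strict_mono_less_eq[OF u(1), of k "b - 1"] by linarith
  have c2: "2 \<le> c" using small[of 1] u(3) b by simp
  show ?case
  proof (cases "m < b")
    case True
    then show ?thesis using small fg by (simp add: to_tm_less nat_change_less)
  next
    case False
    then have m: "b \<le> m" by simp
    obtain e a r where d: "is_decomposition b m (e, a, r)" "e < m" "r < m" "a < b"
      using decompositionE[OF b m] by metis
    show ?thesis
      using less.IH d fg
      by (simp add: to_tm_ge[OF b m d(1)] to_tm_ge[OF c2 nat_change_ge_base[OF b u c m]
            is_decomposition_nat_change[OF b u c m d(1)]])
  qed
qed

section \<open>A single upgrade step\<close>

text \<open>Replaces the \<open>enat\<close> bound by a quantifier over bases, vacuous when there is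
  no next base.\<close>

lemma less_next_base_iff:
  "enat n < next_base B b \<longleftrightarrow> (\<forall>b'\<in>B. b < b' \<longrightarrow> n < b')"
proof (cases "\<exists>b'\<in>B. b < b'")
  case True
  then have ne: "{b' \<in> B. b < b'} \<noteq> {}" by blast
  have "Inf {b' \<in> B. b < b'} \<in> {b' \<in> B. b < b'}" by (rule Inf_nat_def1[OF ne])
  moreover have "Inf {b' \<in> B. b < b'} \<le> b'" if "b' \<in> B" "b < b'" for b'
    using that by (intro cInf_lower) auto
  ultimately show ?thesis using True by (auto simp: next_base_def intro: less_le_trans)
qed (auto simp: next_base_def)

lemma base_eqI:
  assumes "b \<in> B" "b \<le> n" "\<And>b'. b' \<in> B \<Longrightarrow> b < b' \<Longrightarrow> n < b'"
  shows "base B n = b"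
proof -
  have "Inf B \<le> n" using assms(1,2) by (meson cInf_lower bdd_below_bot order_trans)
  moreover have "Max {b \<in> B. b \<le> n} = b"
    using assms by (intro Max_eqI) (auto intro: leI dest: leD)
  ultimately show ?thesis by (simp add: base_def)
qed

lemma base_less:
  assumes "Inf B \<le> n" "b' \<in> B" "base B n < b'"
  shows "n < b'"
proof (rule ccontr)
  assume "\<not> n < b'"
  then have "b' \<le> Max {b \<in> B. b \<le> n}" using assms by (intro Max_ge) auto
  then show False using assms by (simp add: base_def)
qed

lemma base_hierarchy_Inf:
  assumes "base_hierarchy B"
  shows "Inf B \<in> B" "2 \<le> Inf B"
proof -
  show "Inf B \<in> B" using assms by (simp add: base_hierarchy_def Inf_nat_def1)
  then have "Inf B \<noteq> 0" "Inf B \<noteq> 1" using assms by (auto simp: base_hierarchy_def)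
  then show "2 \<le> Inf B" by linarith
qed

lemma Inf_le_mem: "b \<in> B \<Longrightarrow> Inf B \<le> (b::nat)"
  by (intro cInf_lower) auto

text \<open>The next base is a multiple of \<open>b\<close>, like \<open>m\<close>, so it exceeds
  \<open>m\<close> by at least \<open>b\<close>. The divisibility condition on hierarchies enters
  here.\<close>

lemma base_hierarchy_add_less:
  assumes B: "base_hierarchy B" and b: "b \<in> B" "b dvd m" "r < b"
    and m: "\<And>b'. b' \<in> B \<Longrightarrow> b < b' \<Longrightarrow> m < b'" and b': "b' \<in> B" "b < b'"
  shows "m + r < b'"
proof -
  have ex: "\<exists>b'\<in>B. b < b'" using b' by blast
  define s where "s = Inf {b' \<in> B. b < b'}"
  have "s \<in> {b' \<in> B. b < b'}" unfolding s_def using b' by (intro Inf_nat_def1) blast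
  then have s: "m < s" using m by blast
  have "next_base B b = enat s" using ex by (auto simp: next_base_def s_def)
  then have "enat b dvd enat s" using B b(1) by (auto simp: base_hierarchy_def)
  then have "b dvd s" using b(3) by (simp add: enat_dvd_enat_iff)
  then have "b dvd s - m" using b(2) by simp
  then have "b \<le> s - m" using s by (intro dvd_imp_le) auto
  then have "m + r < s" using b(3) by linarith
  also have "s \<le> b'" unfolding s_def using b' by (intro Inf_le_mem) auto
  finally show ?thesis .
qed

locale upgrade_step =
  fixes B C :: "nat set"
  assumes B: "base_hierarchy B" and C: "base_hierarchy C" and good: "good_successor B C"
begin

definition up :: "nat \<Rightarrow> nat" where
  "up n = the_enat (upgrade B C n)"

lemma upgrade_eq_up: "upgrade B C n = enat (up n)"
proof -
  have "upgrade B C n \<noteq> \<infinity>" using good by (auto simp: good_successor_def)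
  then show ?thesis by (auto simp: up_def)
qed

lemma Inf_le: "Inf B \<le> Inf C"
  using good by (simp add: good_successor_def)

lemma up_less: "n < Inf B \<Longrightarrow> up n = n"
  by (simp add: up_def upgrade_less)

lemma up_0: "up 0 = 0" and up_1: "up 1 = 1"
  using base_hierarchy_Inf(2)[OF B] by (auto intro: up_less)

lemma is_witness_iff:
  assumes "Inf B \<le> n"
  shows "is_witness B C n c \<longleftrightarrow> c \<in> C \<and> up (n - 1) < nat_change up (base B n) c n \<and>
    (\<forall>c'\<in>C. c < c' \<longrightarrow> nat_change up (base B n) c n < c')"
proof -
  have "upgrade B C = (\<lambda>k. enat (up k))" using upgrade_eq_up by blast
  then show ?thesis
    using base_hierarchy_base(3)[OF B assms]
    by (simp add: is_witness_def base_change_eq_nat_change less_next_base_iff)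
qed

lemma witness_exists:
  assumes n: "Inf B \<le> n"
  obtains c where "c \<in> C" "up n = nat_change up (base B n) c n" "up (n - 1) < up n"
    "\<And>c'. c' \<in> C \<Longrightarrow> c < c' \<Longrightarrow> up n < c'"
    "\<And>c'. c' \<in> C \<Longrightarrow> c' < c \<Longrightarrow> \<not> (up (n - 1) < nat_change up (base B n) c' n \<and>
      (\<forall>d\<in>C. c' < d \<longrightarrow> nat_change up (base B n) c' n < d))"
proof -
  have eq: "upgrade B C = (\<lambda>k. enat (up k))" using upgrade_eq_up by blast
  define c where "c = (LEAST c. is_witness B C n c)"
  \<comment> \<open>Finiteness of upgrades excludes the branch with value \<infinity>.\<close>
  have ex: "\<exists>c. is_witness B C n c"
    using upgrade_ge[OF B n, of C] upgrade_eq_up[of n] by (auto split: if_splits)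
  then have c: "is_witness B C n c" unfolding c_def by (rule LeastI_ex)
  have min: "\<not> is_witness B C n c'" if "c' < c" for c'
    using that unfolding c_def by (rule not_less_Least)
  have "upgrade B C n = base_change (upgrade B C) (base B n) c n"
    using upgrade_ge[OF B n, of C] ex by (simp add: c_def)
  then have up: "up n = nat_change up (base B n) c n"
    using base_hierarchy_base(3)[OF B n] by (simp add: eq base_change_eq_nat_change)
  show ?thesis
  proof (rule that[of c])
    show "c \<in> C" "up (n - 1) < up n" "\<And>c'. c' \<in> C \<Longrightarrow> c < c' \<Longrightarrow> up n < c'"
      using c unfolding up by (auto simp: is_witness_iff[OF n])
  next
    fix c' assume "c' \<in> C" "c' < c"
    with min[of c'] show "\<not> (up (n - 1) < nat_change up (base B n) c' n \<and>
      (\<forall>d\<in>C. c' < d \<longrightarrow> nat_change up (base B n) c' n < d))"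
      by (auto simp: is_witness_iff[OF n])
  qed (rule up)
qed

lemma up_strict_mono: "strict_mono up"
proof (rule strict_mono_Suc_iff[THEN iffD2], intro allI)
  fix n
  show "up n < up (Suc n)"
  proof (cases "Suc n < Inf B")
    case True
    then show ?thesis by (simp add: up_less)
  next
    case False
    then have "Inf B \<le> Suc n" by simp
    then show ?thesis by (rule witness_exists) simp
  qed
qed

lemma base_of_base:
  assumes "Inf B \<le> n"
  shows "base B (base B n) = base B n"
  using base_hierarchy_base[OF B assms] by (intro base_eqI) auto

lemma nat_change_self: "2 \<le> b \<Longrightarrow> nat_change up b c b = c"
  using nat_change_base[of b up c 1] up_0 up_1 by (simp add: nat_change_less)

text \<open>A base is its own base and is changed to the witness itself, which belongs to
  \<open>C\<close>.\<close>

lemma up_base: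
  assumes "Inf B \<le> n"
  shows "up (base B n) \<in> C"
proof -
  note b = base_hierarchy_base[OF B assms]
  have "Inf B \<le> base B n" using b(1) by (rule Inf_le_mem)
  then show ?thesis
    by (rule witness_exists) (simp add: base_of_base[OF assms] nat_change_self[OF b(3)])
qed

text \<open>The witness for \<open>n\<close> appears here as the base of \<open>up n\<close>, with which it coincides.\<close>

lemma up_witness:
  assumes n: "Inf B \<le> n"
  shows "up (base B n - 1) < base C (up n)"
    and "up n = nat_change up (base B n) (base C (up n)) n"
    and "base C (up n) \<in> C"
    and "Inf C \<le> up n"
    and "\<And>c'. c' \<in> C \<Longrightarrow> c' < base C (up n) \<Longrightarrow> up (n - 1) < nat_change up (base B n) c' n \<Longrightarrow>
      (\<And>d. d \<in> C \<Longrightarrow> c' < d \<Longrightarrow> nat_change up (base B n) c' n < d) \<Longrightarrow> False"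
proof -
  note b = base_hierarchy_base[OF B n]
  note u = up_strict_mono up_0 up_1
  obtain c where c: "c \<in> C" "up n = nat_change up (base B n) c n" "up (n - 1) < up n"
    "\<And>c'. c' \<in> C \<Longrightarrow> c < c' \<Longrightarrow> up n < c'"
    "\<And>c'. c' \<in> C \<Longrightarrow> c' < c \<Longrightarrow> \<not> (up (n - 1) < nat_change up (base B n) c' n \<and>
      (\<forall>d\<in>C. c' < d \<longrightarrow> nat_change up (base B n) c' n < d))"
    using witness_exists[OF n] by blast
  have "up (base B n) \<le> up n" using b(2) u(1) by (simp add: strict_mono_less_eq)
  \<comment> \<open>The image of the base lies in \<open>C\<close>; were it above the witness
    \<open>c\<close>, it would bound \<open>up n\<close> strictly from above. This yields the digit
    condition of \<open>nat_change_strict_mono\<close>.\<close>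
  then have "\<not> c < up (base B n)" using c(4)[OF up_base[OF n]] by linarith
  moreover have "up (base B n - 1) < up (base B n)" using b(3) by (intro strict_monoD[OF u(1)]) simp
  ultimately have lt: "up (base B n - 1) < c" by linarith
  have le: "c \<le> up n" unfolding c(2) by (rule nat_change_ge_base[OF b(3) u lt b(2)])
  have eq: "base C (up n) = c" using c(1) le c(4) by (rule base_eqI)
  show "up (base B n - 1) < base C (up n)" using lt eq by simp
  show "up n = nat_change up (base B n) (base C (up n)) n" using c(2) eq by simp
  show "base C (up n) \<in> C" using c(1) eq by simp
  show "Inf C \<le> up n" using Inf_le_mem[OF c(1)] le by linarith
  show "c' \<in> C \<Longrightarrow> c' < base C (up n) \<Longrightarrow> up (n - 1) < nat_change up (base B n) c' n \<Longrightarrow>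
      (\<And>d. d \<in> C \<Longrightarrow> c' < d \<Longrightarrow> nat_change up (base B n) c' n < d) \<Longrightarrow> False" for c'
    using c(5)[of c'] eq by blast
qed

text \<open>The last condition on good successors in contrapositive form: a multiple beyond
  \<open>up (b - 1)\<close> has passed the next base.\<close>

lemma good_multiple:
  assumes "b \<in> B" "Inf B < b" "base C (up (b - 1)) dvd k" "up (b - 1) < k"
  shows "\<exists>c\<in>C. up (b - 1) < c \<and> c \<le> k"
proof (rule ccontr)
  assume "\<not> ?thesis"
  then have "enat k < next_base C (up (b - 1))" by (auto simp: less_next_base_iff)
  then show False
    using good assms by (auto simp: good_successor_def up_def Let_def)
qed

text \<open>Since each base divides the next, adding a remainder below the base to a multiple of the
  base never reaches the next base; hence the witness does not change.\<close>

lemma up_add: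
  assumes M: "Inf B \<le> M" "base B M dvd M" and r: "r < base B M"
  shows "up (M + r) = up M + up r" "base C (up M) dvd up M" "up r < base C (up M)"
proof -
  note b = base_hierarchy_base[OF B M(1)]
  note u = up_strict_mono up_0 up_1
  note w = up_witness[OF M(1)]
  have c0: "0 < base C (up M)" using w(1) by linarith
  show dvd: "base C (up M) dvd up M"
    using nat_change_dvd[OF b(3) c0 u(2,1) M(2)] w(2) by simp
  have small: "up s < base C (up M)" if "s < base B M" for s
    using that w(1) strict_mono_less_eq[OF u(1), of s "base B M - 1"] by linarith
  show "up r < base C (up M)" using r by (rule small)
  have nc: "nat_change up (base B M) (base C (up M)) (M + s) = up M + up s"
    if "s < base B M" for s
    using nat_change_add[where u = up and c = "base C (up M)", OF b(3) u(2) that M(2)] w(2) by simp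
  show "up (M + r) = up M + up r"
    using r
  proof (induction r)
    case 0
    then show ?case using u by simp
  next
    case (Suc r)
    let ?n = "M + Suc r"
    have n: "Inf B \<le> ?n" using M by simp
    have base: "base B ?n = base B M"
    proof (rule base_eqI)
      show "?n < b'" if "b' \<in> B" "base B M < b'" for b'
        using base_hierarchy_add_less[OF B b(1) M(2) Suc.prems base_less[OF M(1)] that] .
    qed (use b in auto)
    note w' = up_witness[OF n, unfolded base]
    have "base C (up M) \<le> up ?n"
      using base_hierarchy_base(2)[OF C w(4)] strict_mono_less_eq[OF u(1), of M ?n] by simp
    then have "\<not> base C (up ?n) < base C (up M)"
      using base_less[OF w'(4) w(3)] by linarith
    \<comment> \<open>The witness for \<open>M\<close> still qualifies at \<open>?n\<close>, so
      leastness forbids a larger one.\<close>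
    moreover have "\<not> base C (up M) < base C (up ?n)"
    proof
      assume "base C (up M) < base C (up ?n)"
      then show False
      proof (rule w'(5)[OF w(3)])
        show "up (?n - 1) < nat_change up (base B M) (base C (up M)) ?n"
          using Suc nc[OF Suc.prems] strict_monoD[OF u(1), of r "Suc r"] by simp
        show "nat_change up (base B M) (base C (up M)) ?n < d"
          if "d \<in> C" "base C (up M) < d" for d
          unfolding nc[OF Suc.prems]
          using base_hierarchy_add_less[OF C w(3) dvd small[OF Suc.prems] base_less[OF w(4)] that] .
      qed
    qed
    ultimately have "base C (up ?n) = base C (up M)" by linarith
    then show ?case using w'(2) nc[OF Suc.prems] by simp
  qed
qed

end

section \<open>The direct limit\<close>

locale dynamical =
  fixes \<B> :: "nat \<Rightarrow> nat set"
  assumes dynamical: "dynamical_hierarchy \<B>"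
begin

sublocale step: upgrade_step "\<B> i" "\<B> (Suc i)" for i
  using dynamical by unfold_locales (auto simp: dynamical_hierarchy_def)

abbreviation up :: "nat \<Rightarrow> nat \<Rightarrow> nat" where
  "up i \<equiv> step.up i"

fun lift :: "nat \<Rightarrow> nat \<Rightarrow> nat \<Rightarrow> nat" where
  "lift i 0 n = n"
| "lift i (Suc d) n = up (i + d) (lift i d n)"

text \<open>The direct limit of the maps \<open>up i\<close> is represented by pairs: \<open>limit i n\<close> is the pair
  \<open>(j, k)\<close> with least \<open>j\<close> such that the number \<open>k\<close> at stage \<open>j\<close> is upgraded to \<open>n\<close> at stage
  \<open>i\<close>.\<close>

fun limit :: "nat \<Rightarrow> nat \<Rightarrow> nat \<times> nat" where
  "limit 0 n = (0, n)"
| "limit (Suc i) n = (if n \<in> range (up i) then limit i (inv (up i) n) else (Suc i, n))"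

definition limit_less :: "nat \<times> nat \<Rightarrow> nat \<times> nat \<Rightarrow> bool" where
  "limit_less x y \<longleftrightarrow> (\<exists>i n m. x = limit i n \<and> y = limit i m \<and> n < m)"

abbreviation W :: "nat \<times> nat \<Rightarrow> bool" where
  "W \<equiv> Wellfounded.accp limit_less"

lemma inj_up: "inj (up i)"
  using step.up_strict_mono by (rule strict_mono_imp_inj_on)

lemma limit_up: "limit (Suc i) (up i n) = limit i n"
  by (simp add: inv_f_f[OF inj_up])

lemma limit_lift: "limit (i + d) (lift i d n) = limit i n"
  by (induction d) (simp_all add: limit_up del: limit.simps)

lemma lift_strict_mono: "n < m \<Longrightarrow> lift i d n < lift i d m"
  by (induction d) (simp_all add: strict_monoD[OF step.up_strict_mono])

text \<open>Lifting the stored pair recovers \<open>n\<close>, whence \<open>limit i\<close> is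
  injective.\<close>

lemma limit_inverse:
  "n = lift (fst (limit i n)) (i - fst (limit i n)) (snd (limit i n)) \<and> fst (limit i n) \<le> i"
proof (induction i arbitrary: n)
  case 0
  show ?case by simp
next
  case (Suc i)
  show ?case
  proof (cases "n \<in> range (up i)")
    case True
    then obtain k where k: "n = up i k" by blast
    from Suc[of k] show ?thesis
      by (simp only: k limit_up) (simp add: Suc_diff_le)
  qed simp
qed

lemma limit_inj: "limit i n = limit i m \<Longrightarrow> n = m"
  using limit_inverse[of n i] limit_inverse[of m i] by metis

lemma limit_lessI: "n < m \<Longrightarrow> limit_less (limit i n) (limit i m)"
  by (auto simp: limit_less_def)

text \<open>A comparison made before stage \<open>i\<close> can be lifted to \<open>i\<close>. One
  made later must stay there, since its smaller number need not come from stage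
  \<open>i\<close>.\<close>

lemma limit_lessE:
  assumes "limit_less x (limit i m)"
  obtains d k where "x = limit (i + d) k" "k < lift i d m"
proof -
  obtain j n m' where j: "x = limit j n" "limit i m = limit j m'" "n < m'"
    using assms by (auto simp: limit_less_def)
  show ?thesis
  proof (cases "i \<le> j")
    case True
    then have "limit j (lift i (j - i) m) = limit j m'"
      using limit_lift[of i "j - i" m] j(2) by simp
    then show ?thesis using that[of "j - i" n] limit_inj j True by fastforce
  next
    case False
    then have "limit i (lift j (i - j) m') = limit i m"
      using limit_lift[of j "i - j" m'] j(2) by simp
    then have "m = lift j (i - j) m'" using limit_inj by blast
    then show ?thesis
      using that[of 0 "lift j (i - j) n"] lift_strict_mono[OF j(3)] limit_lift[of j "i - j" n] j False
      by simp
  qed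
qed

lemma limit_less_trans: "transp limit_less"
proof (rule transpI)
  fix x y z assume xy: "limit_less x y" and yz: "limit_less y z"
  obtain i n m where i: "y = limit i n" "z = limit i m" "n < m"
    using yz by (auto simp: limit_less_def)
  obtain d k where k: "x = limit (i + d) k" "k < lift i d n"
    using xy unfolding i(1) by (rule limit_lessE)
  have "k < lift i d m" using k(2) lift_strict_mono[OF i(3)] by (rule less_trans)
  then show "limit_less x z" using limit_lessI limit_lift k(1) i(2) by metis
qed

section \<open>Closure properties of the accessible part of the limit\<close>

lemma W_downward: "W (limit i n) \<Longrightarrow> m \<le> n \<Longrightarrow> W (limit i m)"
  using limit_lessI[of m n i] by (cases "m = n") (auto intro: accp_downward)

text \<open>Predecessors may first appear at later stages, so all stages have to be checked.\<close>

lemma WI: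
  assumes "\<And>d k. k < lift i d n \<Longrightarrow> W (limit (i + d) k)"
  shows "W (limit i n)"
proof (rule accp.accI)
  fix x assume "limit_less x (limit i n)"
  then show "W x" by (rule limit_lessE) (simp add: assms)
qed

lemma Inf_mono: "Inf (\<B> i) \<le> Inf (\<B> (i + d))"
  by (induction d) (auto intro: order_trans step.Inf_le)

text \<open>Minima of the hierarchies never decrease, so such numbers are fixed by all later
  upgrades and gain no new predecessors.\<close>

lemma W_small: "n < Inf (\<B> i) \<Longrightarrow> W (limit i n)"
proof (induction n arbitrary: i rule: less_induct)
  case (less n)
  have lift: "lift i d n = n" for d
  proof (induction d)
    case (Suc d)
    then show ?case using less.prems Inf_mono[of i d] by (simp add: step.up_less)
  qed simp
  show ?case
  proof (rule WI)
    fix d k assume "k < lift i d n"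
    then have "k < n" by (simp add: lift)
    moreover have "k < Inf (\<B> (i + d))" using less.prems Inf_mono[of i d] \<open>k < n\<close> by linarith
    ultimately show "W (limit (i + d) k)" by (rule less.IH)
  qed
qed

text \<open>Iterates \<open>up_add\<close>; the further conjuncts are its hypotheses at the next
  stage.\<close>

lemma lift_add:
  assumes M: "Inf (\<B> i) \<le> M" "base (\<B> i) M dvd M" and r: "r < base (\<B> i) M"
  shows "lift i d (M + r) = lift i d M + lift i d r \<and> Inf (\<B> (i + d)) \<le> lift i d M \<and>
    base (\<B> (i + d)) (lift i d M) dvd lift i d M \<and> lift i d r < base (\<B> (i + d)) (lift i d M)"
proof (induction d)
  case 0
  then show ?case using assms by simp
next
  case (Suc d)
  then show ?case
    using step.up_add[where i = "i + d" and M = "lift i d M" and r = "lift i d r"]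
      step.up_witness(4)[where i = "i + d" and n = "lift i d M"] by simp
qed

text \<open>Induction on the limit element of \<open>r\<close>: at every later stage, a predecessor
  of the sum is at most the lift of \<open>M\<close>, or is that lift plus a smaller
  remainder.\<close>

lemma W_add:
  assumes "W x"
  shows "x = limit i r \<Longrightarrow> Inf (\<B> i) \<le> M \<Longrightarrow> base (\<B> i) M dvd M \<Longrightarrow> r < base (\<B> i) M \<Longrightarrow>
    W (limit i M) \<Longrightarrow> W (limit i (M + r))"
  using assms
proof (induction arbitrary: i M r rule: accp.induct)
  case (accI x)
  show ?case
  proof (rule WI)
    fix d k assume k: "k < lift i d (M + r)"
    note l = lift_add[OF accI.prems(2-4), of d]
    have WM: "W (limit (i + d) (lift i d M))" using accI.prems(5) by (simp add: limit_lift)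
    show "W (limit (i + d) k)"
    proof (cases "k \<le> lift i d M")
      case True
      with WM show ?thesis by (rule W_downward)
    next
      case False
      define s where "s = k - lift i d M"
      have s: "k = lift i d M + s" "s < lift i d r" using False k l by (auto simp: s_def)
      have "limit_less (limit (i + d) s) x"
        using limit_lessI[OF s(2), of "i + d"] accI.prems(1) by (simp add: limit_lift)
      then show ?thesis
        using accI.IH[OF _ refl] l s WM by simp
    qed
  qed
qed

section \<open>Terms of limit elements and their invariance under upgrades\<close>

definition limit_tm :: "nat \<Rightarrow> nat \<Rightarrow> (nat \<times> nat) tm" where
  "limit_tm i n = to_tm (limit i) (base (\<B> i) n) n"

lemma hierarchy: "base_hierarchy (\<B> i)"
  by (rule step.B)

text \<open>Coefficients are images of numbers below the base, hence of predecessors of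
  \<open>n\<close>.\<close>

lemma acc_limit_tm:
  assumes "Inf (\<B> i) \<le> n" "\<And>k. k < n \<Longrightarrow> W (limit i k)"
  shows "acc_tm limit_less (limit_tm i n)"
proof -
  note b = base_hierarchy_base[OF hierarchy assms(1)]
  have "normal_tm limit_less (limit_tm i n)"
    unfolding limit_tm_def using b(3) by (rule normal_to_tm) (rule limit_lessI)
  then show ?thesis
    using set_to_tm[OF b(3), of "limit i" n] b(2) assms(2)
    by (fastforce simp: acc_tm_def limit_tm_def)
qed

text \<open>Any \<open>c\<close> above the images of the digits gives the same term, not only the
  witness; \<open>between_upgrades\<close> uses this for the base of \<open>k\<close>.\<close>

lemma to_tm_change:
  assumes "Inf (\<B> i) \<le> n" "up i (base (\<B> i) n - 1) < c"
  shows "to_tm (limit (Suc i)) c (nat_change (up i) (base (\<B> i) n) c n) = limit_tm i n"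
  unfolding limit_tm_def
  using base_hierarchy_base(3)[OF hierarchy assms(1)] step.up_strict_mono step.up_0 step.up_1 assms(2)
  by (rule to_tm_nat_change) (rule limit_up)

lemma limit_tm_up:
  assumes "Inf (\<B> i) \<le> n"
  shows "limit_tm (Suc i) (up i n) = limit_tm i n"
  using to_tm_change[OF assms step.up_witness(1)[OF assms]] step.up_witness(2)[OF assms]
  by (simp add: limit_tm_def)

text \<open>Numbers strictly between \<open>up i (N - 1)\<close> and \<open>up i N\<close>: minimality of the witness for \<open>N\<close>
  leaves only those whose term is smaller than that of \<open>N\<close>, and those which condition (3) puts
  into the same block as \<open>up i (b - 1)\<close>.\<close>

lemma between_upgrades:
  assumes N: "Inf (\<B> i) \<le> N" and k: "up i (N - 1) < k" "k < up i N" and kC: "Inf (\<B> (Suc i)) \<le> k"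
    and nless: "\<not> tm_less limit_less (limit_tm (Suc i) k) (limit_tm i N)"
  shows "\<exists>M r. k = M + r \<and> Inf (\<B> (Suc i)) \<le> M \<and> M \<le> up i (N - 1) \<and> r \<le> up i (N - 1) \<and>
    base (\<B> (Suc i)) M dvd M \<and> r < base (\<B> (Suc i)) M"
proof -
  let ?C = "\<B> (Suc i)"
  define b where "b = base (\<B> i) N"
  define c where "c = base ?C k"
  note b = base_hierarchy_base[OF hierarchy N, folded b_def]
  note c = base_hierarchy_base[OF hierarchy kC, folded c_def]
  note cless = base_less[OF kC, folded c_def]
  note u = step.up_strict_mono[of i] step.up_0[of i] step.up_1[of i]
  note w = step.up_witness[OF N, folded b_def]
  have le: "up i (b - 1) \<le> up i (N - 1)" using b u(1) by (simp add: strict_mono_less_eq)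
  have c_le: "c \<le> base ?C (up i N)"
    using base_less[OF w(4) c(1)] c(2) k(2) by linarith
  \<comment> \<open>Otherwise \<open>c\<close> would itself be a witness for \<open>N\<close>, below
    the least one.\<close>
  have "c \<le> up i (b - 1)"
  proof (rule ccontr)
    assume "\<not> c \<le> up i (b - 1)"
    then have lt: "up i (b - 1) < c" by simp
    have "\<not> k < nat_change (up i) b c N"
    proof
      assume "k < nat_change (up i) b c N"
      then have "tm_less limit_less (to_tm (limit (Suc i)) c k)
          (to_tm (limit (Suc i)) c (nat_change (up i) b c N))"
        using c(3) by (intro tm_less_to_tm limit_lessI)
      then show False
        using nless to_tm_change[OF N, folded b_def, OF lt] by (simp add: limit_tm_def c_def)
    qed
    then have ck: "nat_change (up i) b c N \<le> k" by simp
    then have "c \<noteq> base ?C (up i N)" using w(2) k(2) by auto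
    then have "c < base ?C (up i N)" using c_le by simp
    moreover have "nat_change (up i) b c N < d" if "d \<in> ?C" "c < d" for d
      using ck cless[OF that] by linarith
    ultimately have "\<not> up i (N - 1) < nat_change (up i) b c N" using w(5)[OF c(1)] by blast
    \<comment> \<open>For \<open>N = b\<close> the right side is \<open>c\<close>. Otherwise
      \<open>N - 1\<close> has the same base \<open>b\<close> and a witness at most
      \<open>c\<close>, so monotonicity in the base and in the number applies.\<close>
    moreover have "up i (N - 1) < nat_change (up i) b c N"
    proof (cases "N = b")
      case True
      then show ?thesis using lt step.nat_change_self[OF b(3)] by simp
    next
      case False
      then have bN: "b \<le> N - 1" using b(2) by simp
      have N': "Inf (\<B> i) \<le> N - 1" using Inf_le_mem[OF b(1)] bN by linarith
      have base': "base (\<B> i) (N - 1) = b"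
        using b(1) bN by (rule base_eqI) (use base_less[OF N, folded b_def] in fastforce)
      note w' = step.up_witness[OF N', unfolded base']
      have "base ?C (up i (N - 1)) \<le> c"
        using cless[OF w'(3)] base_hierarchy_base(2)[OF hierarchy w'(4)] k(1) by linarith
      then have "nat_change (up i) b (base ?C (up i (N - 1))) (N - 1) \<le> nat_change (up i) b c (N - 1)"
        using w'(1) b(3) by (intro nat_change_mono_base) auto
      also have "\<dots> < nat_change (up i) b c N"
        using b by (intro nat_change_strict_mono[OF b(3) u lt]) simp
      finally show ?thesis using w'(2) by simp
    qed
    ultimately show False by blast
  qed
  have "Inf (\<B> i) < b"
  proof (rule ccontr)
    assume "\<not> Inf (\<B> i) < b"
    then have "b = Inf (\<B> i)" using Inf_le_mem[OF b(1)] by simp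
    then have "up i (b - 1) = b - 1" using b(3) by (intro step.up_less) simp
    then show False
      using \<open>c \<le> up i (b - 1)\<close> Inf_le_mem[OF c(1)] step.Inf_le[of i] \<open>b = Inf (\<B> i)\<close> b(3) by linarith
  qed
  have base_x: "base ?C (up i (b - 1)) = c"
    using c(1) \<open>c \<le> up i (b - 1)\<close> by (rule base_eqI) (use cless le k in fastforce)
  \<comment> \<open>The largest multiple of \<open>c\<close> up to \<open>k\<close>. Were it above
    \<open>up i (b - 1)\<close>, then \<open>good_multiple\<close> would give a base above
    \<open>c\<close> and at most \<open>k\<close>.\<close>
  define M where "M = k - k mod c"
  have M: "k = M + k mod c" "c dvd M" by (simp_all add: M_def)
  have "M \<le> up i (b - 1)"
  proof (rule ccontr)
    assume "\<not> M \<le> up i (b - 1)"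
    then obtain d where "d \<in> ?C" "up i (b - 1) < d" "d \<le> M"
      using step.good_multiple[OF b(1) \<open>Inf (\<B> i) < b\<close>] M(2) base_x by fastforce
    then show False using cless[of d] \<open>c \<le> up i (b - 1)\<close> M(1) by linarith
  qed
  have "0 < M" using M(1) c by (metis add_0 mod_less_divisor not_less less_le_trans pos2 neq0_conv)
  then have cM: "c \<le> M" using M(2) by (simp add: dvd_imp_le)
  have "base ?C M = c"
    using c(1) cM by (rule base_eqI) (use cless M(1) in fastforce)
  moreover have "k mod c < c" using c(3) by simp
  ultimately show ?thesis
    using M cM \<open>M \<le> up i (b - 1)\<close> \<open>c \<le> up i (b - 1)\<close> le Inf_le_mem[OF c(1)]
    by (intro exI[of _ M] exI[of _ "k mod c"]) simp
qed

text \<open>Accessibility induction on the term, which all lifts of \<open>n\<close> share.\<close>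

lemma W_main:
  assumes "Wellfounded.accp (acc_tm_less limit_less) t"
  shows "limit_tm i n = t \<Longrightarrow> Inf (\<B> i) \<le> n \<Longrightarrow> (\<And>k. k < n \<Longrightarrow> W (limit i k)) \<Longrightarrow> W (limit i n)"
  using assms
proof (induction arbitrary: i n rule: accp.induct)
  case (accI t)
  \<comment> \<open>The hypothesis on predecessors is carried from stage to stage; the invariant
    term keeps the outer induction hypothesis applicable.\<close>
  have "(\<forall>k < lift i d n. W (limit (i + d) k)) \<and> Inf (\<B> (i + d)) \<le> lift i d n \<and>
    limit_tm (i + d) (lift i d n) = t" for d
  proof (induction d)
    case 0
    then show ?case using accI.prems by simp
  next
    case (Suc d)
    let ?j = "i + d" and ?N = "lift i d n"
    have N: "Inf (\<B> ?j) \<le> ?N" and t: "limit_tm ?j ?N = t" using Suc by auto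
    have N0: "0 < ?N" using N base_hierarchy_Inf(2)[OF hierarchy, of ?j] by linarith
    \<comment> \<open>\<open>up ?j (?N - 1)\<close> represents the same limit element as
      \<open>?N - 1\<close>, already in \<open>W\<close>.\<close>
    have W1: "W (limit (Suc ?j) k)" if "k \<le> up ?j (?N - 1)" for k
    proof -
      have "W (limit (Suc ?j) (up ?j (?N - 1)))"
        unfolding limit_up using Suc N0 by simp
      then show ?thesis using that by (rule W_downward)
    qed
    \<comment> \<open>Induction on \<open>k\<close> puts all predecessors of \<open>k\<close> at the
      new stage into \<open>W\<close>, as the outer hypothesis requires when the term of
      \<open>k\<close> is smaller.\<close>
    have "W (limit (Suc ?j) k)" if "k < up ?j ?N" for k
      using that
    proof (induction k rule: less_induct)
      case (less k)
      show ?case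
      proof (cases "k \<le> up ?j (?N - 1) \<or> k < Inf (\<B> (Suc ?j))")
        case True
        then show ?thesis using W1 W_small by blast
      next
        case False
        then have k: "up ?j (?N - 1) < k" "Inf (\<B> (Suc ?j)) \<le> k" by auto
        have Wk: "W (limit (Suc ?j) k')" if "k' < k" for k'
          using that less by simp
        show ?thesis
        proof (cases "tm_less limit_less (limit_tm (Suc ?j) k) t")
          case True
          have "acc_tm limit_less t"
            using acc_limit_tm[OF N] Suc t by simp
          then have "acc_tm_less limit_less (limit_tm (Suc ?j) k) t"
            using True acc_limit_tm[OF k(2) Wk] by (simp add: acc_tm_less_def)
          then show ?thesis using k(2) Wk by (rule accI.IH[OF _ refl])
        next
          \<comment> \<open>Here \<open>k\<close> splits into two parts bounded by
            \<open>up ?j (?N - 1)\<close>, so \<open>W1\<close> covers both and \<open>W_add\<close>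
            their sum.\<close>
          case False
          then obtain M r where M: "k = M + r" "Inf (\<B> (Suc ?j)) \<le> M" "M \<le> up ?j (?N - 1)"
            "r \<le> up ?j (?N - 1)" "base (\<B> (Suc ?j)) M dvd M" "r < base (\<B> (Suc ?j)) M"
            using between_upgrades[OF N k(1) less.prems k(2)] t by auto
          show ?thesis
            unfolding M(1) using W1[OF M(4)] refl M(2,5,6) W1[OF M(3)] by (rule W_add)
        qed
      qed
    qed
    then show ?case
      using limit_tm_up[OF N] step.up_witness(4)[OF N] t by simp
  qed
  then have "W (limit (i + d) k)" if "k < lift i d n" for d k
    using that by simp
  then show ?case by (rule WI)
qed

lemma W_limit: "W (limit i n)"
proof (induction n rule: less_induct)
  case (less n)
  show ?case
  proof (cases "n < Inf (\<B> i)")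
    case True
    then show ?thesis by (rule W_small)
  next
    case False
    then have n: "Inf (\<B> i) \<le> n" by simp
    show ?thesis
      using accp_acc_tm_less[OF limit_less_trans acc_limit_tm[OF n less.IH]] refl n less.IH
      by (rule W_main)
  qed
qed

text \<open>Upgrading preserves the limit element and subtracting 1 lowers it, so accessibility
  induction reaches 0.\<close>

lemma goodstein_terminates: "\<exists>j. goodstein \<B> j m = 0"
proof -
  have "x = limit i (goodstein \<B> i m) \<Longrightarrow> ?thesis" if "W x" for x i
    using that
  proof (induction arbitrary: i rule: accp.induct)
    case (accI x)
    show ?case
    proof (cases "goodstein \<B> i m = 0")
      case False
      let ?g = "goodstein \<B> i m"
      \<comment> \<open>Positivity ensures that the truncated subtraction of 1 is a strict
        decrease.\<close>
      have "0 < up i ?g"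
        using strict_monoD[OF step.up_strict_mono[of i], of 0 ?g] False by simp
      then have "goodstein \<B> (Suc i) m < up i ?g"
        using False by (simp add: step.up_def)
      then have "limit_less (limit (Suc i) (goodstein \<B> (Suc i) m)) x"
        using limit_lessI[of _ "up i ?g" "Suc i"] accI.prems unfolding limit_up by blast
      then show ?thesis by (rule accI.IH[OF _ refl])
    qed blast
  qed
  then show ?thesis using W_limit[of 0 "goodstein \<B> 0 m"] by blast
qed

end

theorem theorem4p12:
  fixes \<B> :: "nat \<Rightarrow> nat set" and m :: nat
  assumes "dynamical_hierarchy \<B>"
  shows "\<exists>i. goodstein \<B> i m = 0"
proof -
  interpret dynamical \<B> using assms by unfold_locales
  show ?thesis by (rule goodstein_terminates)
qed

end
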